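(* For any real $\epsilon>0$ there exists a real number $\alpha>0$ such that for all sufficiently large real $X$ there exists a subset $A$ of the integers in $[1,X]$ satisfying $|A|\geq \alpha X$ and $|A/A| < \epsilon\,\alpha^2X^2$.
   Context: For subsets $A$ and $B$ of the integers $\geq 1$, $A/B$ denotes the subset of $\mathbf{Q}$ consisting of all rational numbers expressible as $a/b$ with $(a,b)\in A\times B$ (each rational number is counted once); in particular $A/A=\{a/a' : a,a'\in A\}$. $|\cdot|$ denotes cardinality. "For all sufficiently large $X$" means for all $X\geq X_0$, where $X_0$ may depend on $\epsilon$ and $\alpha$. *)

theory Defs
  imports Complex_Main
begin

(* A/B as a set of rationals, so each value is counted once by card. It is
   meant for sets of positive integers: Isabelle's x / 0 = 0 would otherwise add 0. *)
definition quotient_set :: "nat set \<Rightarrow> nat set \<Rightarrow> rat set" where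
  "quotient_set A B = {of_nat a / of_nat b | a b. a \<in> A \<and> b \<in> B}"

end

theory Submission
  imports Defs
begin

text \<open>
  Let \<open>A\<close> be a set of integers in \<open>[1, Y]\<close> and let \<open>q\<close> be large. The dilates \<open>qA\<close> and
  \<open>(q + 1)A\<close> lie in \<open>[1, (q + 1)Y]\<close>. As \<open>q\<close> and \<open>q + 1\<close> are coprime, a common element of the
  dilates is a multiple of \<open>q(q + 1)\<close>, so the dilates share at most \<open>Y/q\<close> elements, and their
  union has almost \<open>2|A|\<close> elements (\<open>card_consecutive_dilates\<close>). Every quotient of two elements
  of the union is a quotient from \<open>A/A\<close> times one of the three numbers
  \<open>1\<close>, \<open>q/(q + 1)\<close>, \<open>(q + 1)/q\<close>, because the common factor \<open>q\<close> or \<open>q + 1\<close> cancels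
  (\<open>card_quotient_set_consecutive_dilates\<close>). So \<open>|A/A|\<close> grows by a factor of at most \<open>3\<close> while
  \<open>|A|\<^sup>2\<close> grows by a factor close to \<open>4\<close>.

  Each such step therefore multiplies the attainable \<open>\<epsilon>\<close> by a factor as near to \<open>3/4\<close> as desired,
  say \<open>4/5\<close>, at the price of a smaller density \<open>\<alpha>\<close> (\<open>few_quotients_step\<close>). Starting from the full
  interval, iteration brings \<open>\<epsilon>\<close> below any positive bound.
\<close>

lemma quotient_set_eq_image:
  "quotient_set A B = (\<lambda>(a, b). of_nat a / of_nat b) ` (A \<times> B)"
  unfolding quotient_set_def by auto

lemma finite_quotient_set:
  "finite A \<Longrightarrow> finite B \<Longrightarrow> finite (quotient_set A B)"
  by (simp add: quotient_set_eq_image)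

lemma card_quotient_set_le:
  "finite A \<Longrightarrow> finite B \<Longrightarrow> card (quotient_set A B) \<le> card A * card B"
  unfolding quotient_set_eq_image card_cartesian_product[symmetric]
  by (intro card_image_le finite_cartesian_product)

definition positive_upto :: "real \<Rightarrow> nat set" where
  "positive_upto X = {n. 1 \<le> n \<and> real n \<le> X}"

lemma positive_upto_eq: "positive_upto X = {1..nat \<lfloor>X\<rfloor>}"
  unfolding positive_upto_def by (auto simp: le_nat_floor) linarith

lemma finite_positive_upto: "finite (positive_upto X)"
  by (simp add: positive_upto_eq)

lemma card_positive_upto_le: "X \<ge> 0 \<Longrightarrow> real (card (positive_upto X)) \<le> X"
  by (simp add: positive_upto_eq)

definition consecutive_dilates :: "nat \<Rightarrow> nat set \<Rightarrow> nat set" where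
  "consecutive_dilates q A = (*) q ` A \<union> (*) (Suc q) ` A"

lemma consecutive_dilates_subset:
  assumes "A \<subseteq> positive_upto Y" "q > 0"
  shows "consecutive_dilates q A \<subseteq> positive_upto (real (Suc q) * Y)"
proof
  fix n
  assume "n \<in> consecutive_dilates q A"
  then obtain a c where n: "n = c * a" "a \<in> A" "c = q \<or> c = Suc q"
    unfolding consecutive_dilates_def by blast
  have a: "1 \<le> a" "real a \<le> Y"
    using n(2) assms(1) by (auto simp: positive_upto_def)
  have c: "1 \<le> c" "c \<le> Suc q"
    using n(3) assms(2) by auto
  have "real c * real a \<le> real (Suc q) * Y"
    using a c by (intro mult_mono) auto
  moreover have "1 \<le> c * a"
    using a c by simp
  ultimately show "n \<in> positive_upto (real (Suc q) * Y)"
    by (simp add: positive_upto_def n(1))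
qed

text \<open>
  The overlap of the two dilates is counted through multiples of \<open>q(q + 1)\<close>: if
  \<open>q a = (q + 1) b\<close> then coprimality makes \<open>b = q m\<close>, and \<open>m \<le> Y/q\<close>.
\<close>

lemma card_consecutive_dilates:
  assumes A: "A \<subseteq> positive_upto Y" and Y: "Y \<ge> 0" and q: "q > 0"
  shows "real (card (consecutive_dilates q A)) \<ge> 2 * real (card A) - Y / real q"
proof -
  have fin: "finite A"
    using A finite_positive_upto finite_subset by blast
  have "(*) q ` A \<inter> (*) (Suc q) ` A
        \<subseteq> (\<lambda>m. Suc q * (q * m)) ` positive_upto (Y / real q)"
  proof
    fix x
    assume "x \<in> (*) q ` A \<inter> (*) (Suc q) ` A"
    then obtain a b where ab: "x = q * a" "x = Suc q * b" "b \<in> A"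
      by blast
    have "q dvd Suc q * b"
      using ab by (metis dvd_triv_left)
    then have "q dvd b"
      by (simp add: coprime_dvd_mult_right_iff del: mult_Suc)
    then obtain m where m: "b = q * m" ..
    have b: "1 \<le> b" "real b \<le> Y"
      using ab(3) A by (auto simp: positive_upto_def)
    have "1 \<le> m"
      using b(1) m by (cases m) auto
    moreover have "real m \<le> Y / real q"
      using b(2) m q by (simp add: field_simps)
    ultimately show "x \<in> (\<lambda>m. Suc q * (q * m)) ` positive_upto (Y / real q)"
      using ab(2) m by (auto simp: positive_upto_def)
  qed
  then have "card ((*) q ` A \<inter> (*) (Suc q) ` A) \<le> card (positive_upto (Y / real q))"
    by (meson finite_positive_upto surj_card_le)
  also have "real \<dots> \<le> Y / real q"
    using Y by (intro card_positive_upto_le) simp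
  finally have overlap: "real (card ((*) q ` A \<inter> (*) (Suc q) ` A)) \<le> Y / real q"
    by simp
  have "card ((*) c ` A) = card A" if "c > 0" for c :: nat
    using that by (intro card_image) (auto simp: inj_on_def)
  then have "card (consecutive_dilates q A) + card ((*) q ` A \<inter> (*) (Suc q) ` A) = 2 * card A"
    using card_Un_Int[of "(*) q ` A" "(*) (Suc q) ` A"] fin q
    by (simp add: consecutive_dilates_def del: mult_Suc)
  with overlap show ?thesis
    by linarith
qed

lemma card_quotient_set_consecutive_dilates:
  assumes fin: "finite A" and q: "q > 0"
  shows "card (quotient_set (consecutive_dilates q A) (consecutive_dilates q A))
           \<le> 3 * card (quotient_set A A)"
proof -
  define R :: "rat set"
    where "R = {1, of_nat q / of_nat (Suc q), of_nat (Suc q) / of_nat q}"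
  define Q where "Q = quotient_set A A"
  have "quotient_set (consecutive_dilates q A) (consecutive_dilates q A)
          \<subseteq> (\<lambda>(r, x). r * x) ` (R \<times> Q)"
  proof
    fix z
    assume "z \<in> quotient_set (consecutive_dilates q A) (consecutive_dilates q A)"
    then obtain c d a b where z: "z = of_nat (c * a) / of_nat (d * b)"
      and cd: "c \<in> {q, Suc q}" "d \<in> {q, Suc q}" and ab: "a \<in> A" "b \<in> A"
      unfolding quotient_set_def consecutive_dilates_def by blast
    have "of_nat q \<noteq> (0::rat)" "of_nat (Suc q) \<noteq> (0::rat)"
      using q by (simp_all del: of_nat_Suc)
    then have "of_nat c / of_nat d \<in> R"
      using cd unfolding R_def by (auto simp del: of_nat_Suc)
    moreover have "of_nat a / of_nat b \<in> Q"
      using ab by (auto simp: Q_def quotient_set_def)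
    moreover have "z = (of_nat c / of_nat d) * (of_nat a / of_nat b)"
      by (simp add: z)
    ultimately show "z \<in> (\<lambda>(r, x). r * x) ` (R \<times> Q)"
      by force
  qed
  moreover have "finite (R \<times> Q)"
    using finite_quotient_set[OF fin fin] by (simp add: R_def Q_def)
  ultimately have "card (quotient_set (consecutive_dilates q A) (consecutive_dilates q A))
      \<le> card (R \<times> Q)"
    by (meson surj_card_le)
  also have "\<dots> = card R * card Q"
    by (rule card_cartesian_product)
  also have "\<dots> \<le> 3 * card Q"
    unfolding R_def by (intro mult_right_mono) (auto simp: card_insert_if)
  finally show ?thesis
    by (simp add: Q_def)
qed

definition few_quotients :: "real \<Rightarrow> bool" where
  "few_quotients \<epsilon> \<longleftrightarrow> (\<exists>\<alpha>>0. \<exists>X\<^sub>0. \<forall>X\<ge>X\<^sub>0. \<exists>A \<subseteq> positive_upto X.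
     real (card A) \<ge> \<alpha> * X \<and> real (card (quotient_set A A)) < \<epsilon> * \<alpha>\<^sup>2 * X\<^sup>2)"

lemma few_quotients_mono:
  assumes "few_quotients \<epsilon>" "\<epsilon> \<le> \<epsilon>'"
  shows "few_quotients \<epsilon>'"
proof -
  have "\<epsilon> * \<alpha>\<^sup>2 * X\<^sup>2 \<le> \<epsilon>' * \<alpha>\<^sup>2 * X\<^sup>2" for \<alpha> X :: real
    using assms(2) by (intro mult_right_mono) auto
  with assms(1) show ?thesis
    unfolding few_quotients_def by (meson order_less_le_trans)
qed

lemma few_quotients_interval: "few_quotients 5"
proof -
  have "\<exists>A \<subseteq> positive_upto X. real (card A) \<ge> 1/2 * X
          \<and> real (card (quotient_set A A)) < 5 * (1/2)\<^sup>2 * X\<^sup>2" if X: "X \<ge> 2" for X :: real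
  proof (intro exI conjI)
    let ?A = "positive_upto X"
    show "?A \<subseteq> positive_upto X" ..
    show "real (card ?A) \<ge> 1/2 * X"
      unfolding positive_upto_eq using X by simp linarith
    have "card (quotient_set ?A ?A) \<le> card ?A * card ?A"
      by (intro card_quotient_set_le finite_positive_upto)
    then have "real (card (quotient_set ?A ?A)) \<le> real (card ?A) * real (card ?A)"
      by (metis of_nat_le_iff of_nat_mult)
    also have "\<dots> \<le> X * X"
      using X by (intro mult_mono card_positive_upto_le) auto
    also have "\<dots> < 5 * (1/2)\<^sup>2 * X\<^sup>2"
      using X by (simp add: power2_eq_square)
    finally show "real (card (quotient_set ?A ?A)) < 5 * (1/2)\<^sup>2 * X\<^sup>2" .
  qed
  then show ?thesis
    unfolding few_quotients_def by (intro exI[of _ "1/2"] conjI exI[of _ 2]) auto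
qed

text \<open>
  The overlap \<open>Y/q\<close> of the dilates is made negligible against \<open>|A| \<ge> \<alpha>Y\<close> by taking
  \<open>q > 20/\<alpha>\<close>. At least \<open>39/20 \<sqdot> \<alpha>Y\<close> elements then remain, and the gain is
  \<open>3 / (39/20)\<^sup>2 \<le> 4/5\<close>.
\<close>

lemma few_quotients_step:
  assumes "few_quotients \<epsilon>" "\<epsilon> > 0"
  shows "few_quotients (4/5 * \<epsilon>)"
proof -
  obtain \<alpha> X\<^sub>0 where \<alpha>: "\<alpha> > 0"
    and good: "\<And>Y. Y \<ge> X\<^sub>0 \<Longrightarrow> \<exists>A \<subseteq> positive_upto Y. real (card A) \<ge> \<alpha> * Y
        \<and> real (card (quotient_set A A)) < \<epsilon> * \<alpha>\<^sup>2 * Y\<^sup>2"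
    using assms(1) unfolding few_quotients_def by blast
  obtain q where q: "real q > 20 / \<alpha>"
    using reals_Archimedean2 by blast
  have "real q > 0"
    using q \<alpha> by (meson divide_pos_pos less_trans zero_less_numeral)
  then have q0: "q > 0"
    by simp
  have small: "1 / real q \<le> \<alpha> / 20"
    using q \<alpha> \<open>real q > 0\<close> by (simp add: field_simps)
  define N where "N = real (Suc q)"
  define \<beta> where "\<beta> = 39/20 * \<alpha> / N"
  have N: "N > 0"
    by (simp add: N_def)
  have "\<exists>A \<subseteq> positive_upto X. real (card A) \<ge> \<beta> * X
      \<and> real (card (quotient_set A A)) < 4/5 * \<epsilon> * \<beta>\<^sup>2 * X\<^sup>2"
    if X: "X \<ge> max 0 (N * X\<^sub>0)" for X
  proof -
    define Y where "Y = X / N"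
    have XY: "X = N * Y"
      using N by (simp add: Y_def)
    have \<beta>X: "\<beta> * X = 39/20 * \<alpha> * Y"
      using N by (simp add: \<beta>_def XY)
    have Y: "Y \<ge> 0" "Y \<ge> X\<^sub>0"
      using X N by (simp_all add: XY zero_le_mult_iff)
    obtain A where A: "A \<subseteq> positive_upto Y" "real (card A) \<ge> \<alpha> * Y"
        "real (card (quotient_set A A)) < \<epsilon> * \<alpha>\<^sup>2 * Y\<^sup>2"
      using good[OF Y(2)] by blast
    have fin: "finite A"
      using A(1) finite_positive_upto finite_subset by blast
    let ?D = "consecutive_dilates q A"
    have "?D \<subseteq> positive_upto X"
      using consecutive_dilates_subset[OF A(1) q0] by (simp add: XY N_def)
    moreover have "real (card ?D) \<ge> \<beta> * X"
    proof -
      have "Y / real q \<le> \<alpha> / 20 * Y"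
        using mult_right_mono[OF small Y(1)] by simp
      then have "\<beta> * X \<le> 2 * real (card A) - Y / real q"
        using A(2) unfolding \<beta>X by (simp add: field_simps)
      also have "\<dots> \<le> real (card ?D)"
        by (rule card_consecutive_dilates[OF A(1) Y(1) q0])
      finally show ?thesis .
    qed
    moreover have "real (card (quotient_set ?D ?D)) < 4/5 * \<epsilon> * \<beta>\<^sup>2 * X\<^sup>2"
    proof -
      have "real (card (quotient_set ?D ?D)) \<le> 3 * real (card (quotient_set A A))"
        using card_quotient_set_consecutive_dilates[OF fin q0] by linarith
      also have "\<dots> < 3 * (\<epsilon> * \<alpha>\<^sup>2 * Y\<^sup>2)"
        using A(3) by simp
      also have "\<dots> \<le> (4/5 * (39/20)\<^sup>2) * (\<epsilon> * \<alpha>\<^sup>2 * Y\<^sup>2)"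
        using assms(2) by (intro mult_right_mono) (auto simp: power2_eq_square)
      also have "\<dots> = 4/5 * \<epsilon> * (\<beta> * X)\<^sup>2"
        unfolding \<beta>X by (simp add: power2_eq_square)
      also have "\<dots> = 4/5 * \<epsilon> * \<beta>\<^sup>2 * X\<^sup>2"
        by (simp add: power_mult_distrib)
      finally show ?thesis .
    qed
    ultimately show ?thesis
      by blast
  qed
  moreover have "\<beta> > 0"
    using \<alpha> N by (simp add: \<beta>_def)
  ultimately show ?thesis
    unfolding few_quotients_def by blast
qed

lemma few_quotients_iterate: "few_quotients ((4/5) ^ k * 5)"
proof (induction k)
  case 0
  show ?case
    using few_quotients_interval by simp
next
  case (Suc k)
  then show ?case
    using few_quotients_step[OF Suc.IH] by (simp add: mult.assoc)
qed

theorem theorem1p2: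
  fixes \<epsilon> :: real
  assumes "\<epsilon> > 0"
  shows "\<exists>\<alpha>::real. \<alpha> > 0 \<and>
    (\<exists>X\<^sub>0::real. \<forall>X::real. X \<ge> X\<^sub>0 \<longrightarrow>
      (\<exists>A::nat set. A \<subseteq> {n. 1 \<le> n \<and> real n \<le> X} \<and>
        real (card A) \<ge> \<alpha> * X \<and>
        real (card (quotient_set A A)) < \<epsilon> * \<alpha>\<^sup>2 * X\<^sup>2))"
proof -
  obtain k where "(4/5::real) ^ k < \<epsilon> / 5"
    using real_arch_pow_inv[of "\<epsilon> / 5" "4/5"] assms by auto
  then have "(4/5) ^ k * 5 \<le> \<epsilon>"
    by simp
  with few_quotients_iterate have "few_quotients \<epsilon>"
    by (rule few_quotients_mono)
  then show ?thesis
    unfolding few_quotients_def positive_upto_def by blast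
qed

end
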